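(* For every formula $F$ of the language of $\mathsf{S4V}$: if $\mathsf{S4V}\vdash F$ then there is a normal realisation $r$ such that $\mathsf{LPV}\vdash F^r$.
   Context: $\mathsf{S4V}$: classical modal logic with two unary modalities $\Box$ and ${\bf V}$; axioms: all axioms of $\mathsf{S4}$ for $\Box$, ${\bf V}(A\rightarrow B)\rightarrow({\bf V}A\rightarrow{\bf V}B)$, $\Box A\rightarrow{\bf V}A$, $\neg\Box{\bf V}\bot$; rules: Modus Ponens and $\Box$-Necessitation. $\mathsf{LPV}$: language of classical propositional logic extended by ${\bf V}A$ and $t{:}A$, with proof terms built from proof variables and proof constants by binary $\cdot$, $+$ and unary $!$. Axioms: classical propositional tautologies; $t{:}(A\rightarrow B)\rightarrow(s{:}A\rightarrow (t\cdot s){:}B)$; $t{:}A\rightarrow A$; $t{:}A\rightarrow\, !t{:}t{:}A$; $t{:}A\rightarrow (s+t){:}A$, $t{:}A\rightarrow (t+s){:}A$; ${\bf V}(A\rightarrow B)\rightarrow({\bf V}A\rightarrow {\bf V}B)$; $t{:}A\rightarrow {\bf V}A$; $\neg t{:}{\bf V}\bot$. Rules: Modus Ponens and Axiom Necessitation (from an axiom $A$ infer $c{:}A$, $c$ a proof constant). A realisation $r$ of an $\mathsf{S4V}$ formula $F$ replaces each occurrence of $\Box$ in $F$ by a proof term (so $\Box G$ becomes $t{:}G^r$), yielding an $\mathsf{LPV}$ formula $F^r$. Polarity of occurrences of $\Box$: an occurrence in $F$ keeps its polarity in $G\rightarrow F$, $F\land G$, $G\land F$, $F\lor G$, $G\lor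 F$, $\Box F$, and reverses it in $F\rightarrow G$ and $\neg F$; the outermost occurrence in $\Box G$ as a whole formula is positive. A realisation is normal if every negative occurrence of $\Box$ is replaced by a proof variable. *)

theory Defs
  imports Main
begin

text \<open>The languages of S4V and LPV differ only in the labels of the modality \<open>Mod\<close>:
  there is a single label in S4V, where \<open>Mod\<close> is \<open>\<box>\<close>, while in LPV \<open>Mod t A\<close>
  is \<open>t:A\<close> for a proof term \<open>t\<close>. \<open>Ver\<close> is the verification modality \<open>V\<close>.\<close>

datatype 'm fm =
    Atom nat
  | Bot
  | Neg "'m fm"
  | Con "'m fm" "'m fm"
  | Dis "'m fm" "'m fm"
  | Imp "'m fm" "'m fm"  (infixr "\<rightarrow>\<^sub>f" 55)
  | Ver "'m fm"
  | Mod 'm "'m fm"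

datatype tm =
    PVar nat
  | PConst nat
  | App tm tm
  | Sum tm tm
  | Bang tm

type_synonym s4v_fm = "unit fm"
type_synonym lpv_fm = "tm fm"

abbreviation Box :: "s4v_fm \<Rightarrow> s4v_fm" where
  "Box A \<equiv> Mod () A"

abbreviation Prf :: "tm \<Rightarrow> lpv_fm \<Rightarrow> lpv_fm"  (infixr "\<Colon>\<^sub>f" 60) where
  "t \<Colon>\<^sub>f A \<equiv> Mod t A"

text \<open>Tautologies are substitution instances of propositional tautologies: formulas
  with a modality at the root are evaluated like propositional atoms.\<close>

primrec eval :: "('m fm \<Rightarrow> bool) \<Rightarrow> 'm fm \<Rightarrow> bool" where
  "eval v (Atom n) \<longleftrightarrow> v (Atom n)"
| "eval v Bot \<longleftrightarrow> False"
| "eval v (Neg A) \<longleftrightarrow> \<not> eval v A"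
| "eval v (Con A B) \<longleftrightarrow> eval v A \<and> eval v B"
| "eval v (Dis A B) \<longleftrightarrow> eval v A \<or> eval v B"
| "eval v (A \<rightarrow>\<^sub>f B) \<longleftrightarrow> (eval v A \<longrightarrow> eval v B)"
| "eval v (Ver A) \<longleftrightarrow> v (Ver A)"
| "eval v (Mod m A) \<longleftrightarrow> v (Mod m A)"

definition tautology :: "'m fm \<Rightarrow> bool" where
  "tautology A \<longleftrightarrow> (\<forall>v. eval v A)"

inductive S4V_axiom :: "s4v_fm \<Rightarrow> bool" where
  S4V_taut: "tautology A \<Longrightarrow> S4V_axiom A"
| S4V_K: "S4V_axiom (Box (A \<rightarrow>\<^sub>f B) \<rightarrow>\<^sub>f Box A \<rightarrow>\<^sub>f Box B)"
| S4V_T: "S4V_axiom (Box A \<rightarrow>\<^sub>f A)"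
| S4V_4: "S4V_axiom (Box A \<rightarrow>\<^sub>f Box (Box A))"
| S4V_Ver_K: "S4V_axiom (Ver (A \<rightarrow>\<^sub>f B) \<rightarrow>\<^sub>f Ver A \<rightarrow>\<^sub>f Ver B)"
| S4V_Box_Ver: "S4V_axiom (Box A \<rightarrow>\<^sub>f Ver A)"
| S4V_cons: "S4V_axiom (Neg (Box (Ver Bot)))"

inductive S4V :: "s4v_fm \<Rightarrow> bool" where
  S4V_ax: "S4V_axiom A \<Longrightarrow> S4V A"
| S4V_MP: "S4V (A \<rightarrow>\<^sub>f B) \<Longrightarrow> S4V A \<Longrightarrow> S4V B"
| S4V_Nec: "S4V A \<Longrightarrow> S4V (Box A)"

inductive LPV_axiom :: "lpv_fm \<Rightarrow> bool" where
  LPV_taut: "tautology A \<Longrightarrow> LPV_axiom A"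
| LPV_App: "LPV_axiom (t \<Colon>\<^sub>f (A \<rightarrow>\<^sub>f B) \<rightarrow>\<^sub>f s \<Colon>\<^sub>f A \<rightarrow>\<^sub>f App t s \<Colon>\<^sub>f B)"
| LPV_Refl: "LPV_axiom (t \<Colon>\<^sub>f A \<rightarrow>\<^sub>f A)"
| LPV_Bang: "LPV_axiom (t \<Colon>\<^sub>f A \<rightarrow>\<^sub>f Bang t \<Colon>\<^sub>f t \<Colon>\<^sub>f A)"
| LPV_SumR: "LPV_axiom (t \<Colon>\<^sub>f A \<rightarrow>\<^sub>f Sum s t \<Colon>\<^sub>f A)"
| LPV_SumL: "LPV_axiom (t \<Colon>\<^sub>f A \<rightarrow>\<^sub>f Sum t s \<Colon>\<^sub>f A)"
| LPV_Ver_K: "LPV_axiom (Ver (A \<rightarrow>\<^sub>f B) \<rightarrow>\<^sub>f Ver A \<rightarrow>\<^sub>f Ver B)"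
| LPV_Prf_Ver: "LPV_axiom (t \<Colon>\<^sub>f A \<rightarrow>\<^sub>f Ver A)"
| LPV_cons: "LPV_axiom (Neg (t \<Colon>\<^sub>f Ver Bot))"

inductive LPV :: "lpv_fm \<Rightarrow> bool" where
  LPV_ax: "LPV_axiom A \<Longrightarrow> LPV A"
| LPV_MP: "LPV (A \<rightarrow>\<^sub>f B) \<Longrightarrow> LPV A \<Longrightarrow> LPV B"
| LPV_AN: "LPV_axiom A \<Longrightarrow> LPV (PConst c \<Colon>\<^sub>f A)"

text \<open>An occurrence of a subformula is addressed by the path leading to it from the
  root, each step selecting the 0th or the 1st immediate subformula. A realisation of a
  formula maps the occurrences of \<open>\<box>\<close> in it to proof terms, so that different
  occurrences may receive different terms; its values at other paths are irrelevant.\<close>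

type_synonym path = "nat list"

type_synonym realisation = "path \<Rightarrow> tm"

fun realise :: "realisation \<Rightarrow> s4v_fm \<Rightarrow> lpv_fm" where
  "realise r (Atom n) = Atom n"
| "realise r Bot = Bot"
| "realise r (Neg A) = Neg (realise (\<lambda>p. r (0 # p)) A)"
| "realise r (Con A B) = Con (realise (\<lambda>p. r (0 # p)) A) (realise (\<lambda>p. r (1 # p)) B)"
| "realise r (Dis A B) = Dis (realise (\<lambda>p. r (0 # p)) A) (realise (\<lambda>p. r (1 # p)) B)"
| "realise r (A \<rightarrow>\<^sub>f B) = realise (\<lambda>p. r (0 # p)) A \<rightarrow>\<^sub>f realise (\<lambda>p. r (1 # p)) B"
| "realise r (Ver A) = Ver (realise (\<lambda>p. r (0 # p)) A)"
| "realise r (Box A) = r [] \<Colon>\<^sub>f realise (\<lambda>p. r (0 # p)) A"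

text \<open>\<open>box_occs True F\<close> and \<open>box_occs False F\<close> are the sets of positive and of negative
  occurrences of \<open>\<box>\<close> in \<open>F\<close>.\<close>

fun box_occs :: "bool \<Rightarrow> s4v_fm \<Rightarrow> path set" where
  "box_occs s (Atom n) = {}"
| "box_occs s Bot = {}"
| "box_occs s (Neg A) = (#) 0 ` box_occs (\<not> s) A"
| "box_occs s (Con A B) = (#) 0 ` box_occs s A \<union> (#) 1 ` box_occs s B"
| "box_occs s (Dis A B) = (#) 0 ` box_occs s A \<union> (#) 1 ` box_occs s B"
| "box_occs s (A \<rightarrow>\<^sub>f B) = (#) 0 ` box_occs (\<not> s) A \<union> (#) 1 ` box_occs s B"
| "box_occs s (Ver A) = (#) 0 ` box_occs s A"
| "box_occs s (Box A) = (if s then {[]} else {}) \<union> (#) 0 ` box_occs s A"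

definition normal_realisation :: "realisation \<Rightarrow> s4v_fm \<Rightarrow> bool" where
  "normal_realisation r F \<longleftrightarrow> (\<forall>p \<in> box_occs False F. \<exists>x. r p = PVar x)"

end

theory Submission
  imports Defs "HOL-Library.Nat_Bijection"
begin

text \<open>The argument is semantic (after Fitting) and avoids cut elimination. In the canonical
  model the worlds are the propositional valuations that make all theorems of LPV true, and S4V
  is sound for it. A quasi-realisation may offer finite disjunctions of alternatives under
  positive modalities and uses a separate variable for each negative \<open>\<box>\<close>. If no finite disjunction
  of quasi-realisations of \<open>F\<close> were provable in LPV, some world would refute all of them, hence
  refute \<open>F\<close>. A finite set of quasi-realisations is then condensed into one realisation: going
  through a negative \<open>\<box>\<close> costs an internalised implication with a ground proof \<open>u\<close>, which
  is absorbed by substituting \<open>u \<cdot> x\<close> for the variable of that box.\<close>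

section \<open>Propositional compactness\<close>

definition fin_sat :: "'m fm set \<Rightarrow> bool" where
  "fin_sat S \<longleftrightarrow> (\<forall>T. finite T \<longrightarrow> T \<subseteq> S \<longrightarrow> (\<exists>v. \<forall>A\<in>T. eval v A))"

lemma fin_satD: "fin_sat S \<Longrightarrow> finite T \<Longrightarrow> T \<subseteq> S \<Longrightarrow> \<exists>v. \<forall>A\<in>T. eval v A"
  by (auto simp: fin_sat_def)

lemma fin_sat_Union_chain:
  assumes "subset.chain {S. fin_sat S} C" "C \<noteq> {}"
  shows "fin_sat (\<Union>C)"
  unfolding fin_sat_def
proof (intro allI impI)
  fix T assume T: "finite T" "T \<subseteq> \<Union>C"
  have "\<exists>S\<in>C. T \<subseteq> S"
    using finite_subset_Union_chain[OF T assms(2)] assms(1) by (metis subset_chain_def)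
  then obtain S where "S \<in> C" "T \<subseteq> S" by blast
  moreover have "fin_sat S" using assms(1) \<open>S \<in> C\<close> by (auto simp: subset_chain_def)
  ultimately show "\<exists>v. \<forall>A\<in>T. eval v A" using T(1) fin_satD by blast
qed

text \<open>If both extensions failed, delete \<open>A\<close> and \<open>Neg A\<close> from the two
  finite witnesses: a valuation of what remains decides \<open>A\<close> and so satisfies one
  witness in full.\<close>

lemma fin_sat_insert:
  assumes "fin_sat S"
  shows "fin_sat (insert A S) \<or> fin_sat (insert (Neg A) S)"
proof (rule ccontr)
  assume "\<not> ?thesis"
  then have "\<not> fin_sat (insert A S)" "\<not> fin_sat (insert (Neg A) S)" by simp_all
  then obtain T U where T: "finite T" "T \<subseteq> insert A S" "\<And>v. \<not> (\<forall>B\<in>T. eval v B)"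
    and U: "finite U" "U \<subseteq> insert (Neg A) S" "\<And>v. \<not> (\<forall>B\<in>U. eval v B)"
    unfolding fin_sat_def by meson
  obtain v where v: "\<forall>B\<in>(T - {A}) \<union> (U - {Neg A}). eval v B"
    using fin_satD[OF assms, of "(T - {A}) \<union> (U - {Neg A})"] T(1,2) U(1,2) by blast
  show False
  proof (cases "eval v A")
    case True
    then have "eval v B" if "B \<in> T" for B using v that by (cases "B = A") auto
    with T(3) show False by auto
  next
    case False
    then have "eval v (Neg A)" by simp
    then have "eval v B" if "B \<in> U" for B using v that by (cases "B = Neg A") auto
    with U(3) show False by auto
  qed
qed

text \<open>Zorn's lemma gives a maximal finitely satisfiable \<open>M\<close> above
  \<open>S\<close>. Membership in \<open>M\<close>, used as a valuation, makes exactly the members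
  of \<open>M\<close> true.\<close>

theorem compactness:
  assumes "fin_sat S"
  shows "\<exists>v. \<forall>A\<in>S. eval v A"
proof -
  have "\<exists>M\<in>{M. fin_sat M \<and> S \<subseteq> M}. \<forall>X\<in>{M. fin_sat M \<and> S \<subseteq> M}. M \<subseteq> X \<longrightarrow> X = M"
  proof (rule subset_Zorn_nonempty)
    show "{M. fin_sat M \<and> S \<subseteq> M} \<noteq> {}" using assms by auto
  next
    fix C assume C: "C \<noteq> {}" "subset.chain {M. fin_sat M \<and> S \<subseteq> M} C"
    then have "subset.chain {S. fin_sat S} C" by (auto simp: subset_chain_def)
    then have "fin_sat (\<Union>C)" using C(1) by (rule fin_sat_Union_chain)
    moreover have "S \<subseteq> \<Union>C" using C unfolding subset_chain_def by blast
    ultimately show "\<Union>C \<in> {M. fin_sat M \<and> S \<subseteq> M}" by simp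
  qed
  then obtain M where M: "fin_sat M" "S \<subseteq> M"
    and max: "\<And>X. fin_sat X \<Longrightarrow> M \<subseteq> X \<Longrightarrow> X = M"
    by (smt (verit) mem_Collect_eq order_trans)
  have dec: "A \<in> M \<or> Neg A \<in> M" for A
    using fin_sat_insert[OF M(1), of A] max by (metis insertI1 subset_insertI)
  have closed: "A \<in> M" if "finite T" "T \<subseteq> M" "\<And>v. \<forall>B\<in>T. eval v B \<Longrightarrow> eval v A" for A T
  proof (rule ccontr)
    assume "A \<notin> M"
    then have "insert (Neg A) T \<subseteq> M" using dec that(2) by auto
    then have "\<exists>v. \<forall>B\<in>insert (Neg A) T. eval v B"
      using fin_satD[OF M(1)] that(1) by (metis finite_insert)
    then show False using that(3) by auto
  qed
  have contr: "False" if "finite T" "T \<subseteq> M" "\<And>v. \<not> (\<forall>B\<in>T. eval v B)" for T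
    using fin_satD[OF M(1) that(1,2)] that(3) by blast
  have neg: "Neg A \<in> M \<longleftrightarrow> A \<notin> M" for A
    using dec[of A] contr[of "{A, Neg A}"] by auto
  have "eval (\<lambda>B. B \<in> M) A \<longleftrightarrow> A \<in> M" for A
  proof (induction A)
    case Bot
    then show ?case using contr[of "{Bot}"] by auto
  next
    case (Neg A)
    then show ?case using neg by simp
  next
    case (Con A B)
    have "Con A B \<in> M" if "A \<in> M" "B \<in> M" by (rule closed[of "{A, B}"]) (use that in auto)
    moreover have "A \<in> M" "B \<in> M" if "Con A B \<in> M"
      by (rule closed[of "{Con A B}"]; use that in simp)+
    ultimately show ?case using Con by auto
  next
    case (Dis A B)
    have "Dis A B \<in> M" if "A \<in> M" by (rule closed[of "{A}"]) (use that in auto)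
    moreover have "Dis A B \<in> M" if "B \<in> M" by (rule closed[of "{B}"]) (use that in auto)
    moreover have "B \<in> M" if "Dis A B \<in> M" "A \<notin> M"
      by (rule closed[of "{Dis A B, Neg A}"]) (use that neg in auto)
    ultimately show ?case using Dis by auto
  next
    case (Imp A B)
    have "A \<rightarrow>\<^sub>f B \<in> M" if "A \<notin> M" by (rule closed[of "{Neg A}"]) (use that neg in auto)
    moreover have "A \<rightarrow>\<^sub>f B \<in> M" if "B \<in> M" by (rule closed[of "{B}"]) (use that in auto)
    moreover have "B \<in> M" if "A \<rightarrow>\<^sub>f B \<in> M" "A \<in> M"
      by (rule closed[of "{A \<rightarrow>\<^sub>f B, A}"]) (use that in auto)
    ultimately show ?case using Imp by auto
  qed simp_all
  with M(2) show ?thesis by blast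
qed

section \<open>Propositional reasoning and internalisation in LPV\<close>

text \<open>Curried, so that \<open>App\<close> and the K axiom of \<open>Ver\<close> can discharge
  the premises one at a time.\<close>

definition imps :: "'m fm list \<Rightarrow> 'm fm \<Rightarrow> 'm fm" where
  "imps As B = foldr Imp As B"

definition disjs :: "'m fm list \<Rightarrow> 'm fm" where
  "disjs As = foldr Dis As Bot"

lemma imps_simps [simp]: "imps [] B = B" "imps (A # As) B = A \<rightarrow>\<^sub>f imps As B"
  by (simp_all add: imps_def)

lemma disjs_simps [simp]: "disjs [] = Bot" "disjs (A # As) = Dis A (disjs As)"
  by (simp_all add: disjs_def)

lemma eval_imps [simp]: "eval v (imps As B) \<longleftrightarrow> ((\<forall>A\<in>set As. eval v A) \<longrightarrow> eval v B)"
  by (induction As) auto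

lemma eval_disjs [simp]: "eval v (disjs As) \<longleftrightarrow> (\<exists>A\<in>set As. eval v A)"
  by (induction As) auto

lemma map_fm_disjs: "map_fm f (disjs As) = disjs (map (map_fm f) As)"
  by (induction As) auto

lemma LPV_imps_MP: "LPV (imps As B) \<Longrightarrow> \<forall>A\<in>set As. LPV A \<Longrightarrow> LPV B"
  by (induction As) (auto dest: LPV_MP)

lemma LPV_tautology: "(\<And>v. eval v A) \<Longrightarrow> LPV A"
  by (intro LPV_ax LPV_taut) (simp add: tautology_def)

lemma LPV_entails:
  assumes "\<forall>A\<in>set As. LPV A" "\<And>v. \<forall>A\<in>set As. eval v A \<Longrightarrow> eval v B"
  shows "LPV B"
proof -
  have "LPV (imps As B)" by (rule LPV_tautology) (simp add: assms(2))
  then show ?thesis using assms(1) by (rule LPV_imps_MP)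
qed

lemma LPV_entails1: "LPV A \<Longrightarrow> (\<And>v. eval v A \<Longrightarrow> eval v B) \<Longrightarrow> LPV B"
  using LPV_entails[of "[A]" B] by auto

lemma LPV_entails2:
  "LPV A \<Longrightarrow> LPV A' \<Longrightarrow> (\<And>v. eval v A \<Longrightarrow> eval v A' \<Longrightarrow> eval v B) \<Longrightarrow> LPV B"
  using LPV_entails[of "[A, A']" B] by auto

section \<open>Substitution of proof terms for proof variables\<close>

primrec tsub :: "(nat \<Rightarrow> tm) \<Rightarrow> tm \<Rightarrow> tm" where
  "tsub \<sigma> (PVar n) = \<sigma> n"
| "tsub \<sigma> (PConst c) = PConst c"
| "tsub \<sigma> (App s t) = App (tsub \<sigma> s) (tsub \<sigma> t)"
| "tsub \<sigma> (Sum s t) = Sum (tsub \<sigma> s) (tsub \<sigma> t)"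
| "tsub \<sigma> (Bang t) = Bang (tsub \<sigma> t)"

abbreviation fsub :: "(nat \<Rightarrow> tm) \<Rightarrow> lpv_fm \<Rightarrow> lpv_fm" where
  "fsub \<sigma> \<equiv> map_fm (tsub \<sigma>)"

text \<open>Equivalent to the absence of proof variables.\<close>

definition ground :: "tm \<Rightarrow> bool" where
  "ground t \<longleftrightarrow> (\<forall>\<sigma>. tsub \<sigma> t = t)"

lemma ground_simps [simp]:
  "ground (PConst c)"
  "ground s \<Longrightarrow> ground t \<Longrightarrow> ground (App s t)"
  "ground s \<Longrightarrow> ground t \<Longrightarrow> ground (Sum s t)"
  "ground t \<Longrightarrow> ground (Bang t)"
  by (simp_all add: ground_def)

lemma tsub_ground [simp]: "ground t \<Longrightarrow> tsub \<sigma> t = t"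
  by (simp add: ground_def)

lemma tsub_tsub: "tsub \<sigma> (tsub \<tau> t) = tsub (\<lambda>n. tsub \<sigma> (\<tau> n)) t"
  by (induction t) auto

lemma fsub_fsub: "fsub \<sigma> (fsub \<tau> A) = fsub (\<lambda>n. tsub \<sigma> (\<tau> n)) A"
  by (simp add: fm.map_comp comp_def tsub_tsub)

text \<open>Relabelling only changes modal formulas, which count as atoms here, so it can be moved
  into the valuation. Hence tautologies are closed under substitution.\<close>

lemma eval_map_fm: "eval v (map_fm f A) \<longleftrightarrow> eval (\<lambda>B. v (map_fm f B)) A"
  by (induction A) auto

lemma LPV_axiom_fsub: "LPV_axiom A \<Longrightarrow> LPV_axiom (fsub \<sigma> A)"
proof (induction rule: LPV_axiom.induct)
  case (LPV_taut A)
  then show ?case by (intro LPV_axiom.LPV_taut) (simp add: tautology_def eval_map_fm)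
qed (auto intro: LPV_axiom.intros)

lemma LPV_fsub: "LPV A \<Longrightarrow> LPV (fsub \<sigma> A)"
proof (induction rule: LPV.induct)
  case (LPV_MP A B)
  then show ?case by (auto intro: LPV.LPV_MP)
qed (auto intro: LPV.intros LPV_axiom_fsub)

lemma LPV_App_MP: "LPV (t \<Colon>\<^sub>f (A \<rightarrow>\<^sub>f B)) \<Longrightarrow> LPV (s \<Colon>\<^sub>f A \<rightarrow>\<^sub>f App t s \<Colon>\<^sub>f B)"
  using LPV_MP LPV_ax LPV_App by blast

text \<open>The term mirrors the derivation: a constant for an axiom, \<open>App\<close> for Modus
  Ponens, \<open>Bang\<close> of the constant for Axiom Necessitation. Its leaves are constants, so
  it is ground.\<close>

lemma internalisation:
  assumes "LPV A"
  shows "\<exists>t. ground t \<and> LPV (t \<Colon>\<^sub>f A)"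
  using assms
proof (induction rule: LPV.induct)
  case (LPV_ax A)
  then show ?case using ground_simps(1) LPV_AN by blast
next
  case (LPV_MP A B)
  then obtain t s where "ground t" "LPV (t \<Colon>\<^sub>f (A \<rightarrow>\<^sub>f B))" "ground s" "LPV (s \<Colon>\<^sub>f A)" by auto
  then have "ground (App t s)" "LPV (App t s \<Colon>\<^sub>f B)" by (simp, metis LPV_App_MP LPV.LPV_MP)
  then show ?case by blast
next
  case (LPV_AN A c)
  then have "LPV (PConst c \<Colon>\<^sub>f A)" by (rule LPV.LPV_AN)
  then have "LPV (Bang (PConst c) \<Colon>\<^sub>f PConst c \<Colon>\<^sub>f A)"
    using LPV_axiom.LPV_Bang LPV.LPV_MP LPV.LPV_ax by blast
  then show ?case by (intro exI[of _ "Bang (PConst c)"]) simp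
qed

text \<open>Iterated \<open>Sum\<close> collects the evidence of all members. Since \<open>u\<close>
  is chosen before \<open>A\<close>, it serves every formula at once.\<close>

lemma finite_sum_term:
  assumes "finite T"
  shows "\<exists>u. (\<forall>t\<in>T. \<forall>A. LPV (t \<Colon>\<^sub>f A \<rightarrow>\<^sub>f u \<Colon>\<^sub>f A)) \<and> ((\<forall>t\<in>T. ground t) \<longrightarrow> ground u)"
  using assms
proof (induction rule: finite_induct)
  case empty
  \<comment> \<open>\<open>PConst 0\<close> is an arbitrary ground filler for the empty set.\<close>
  then show ?case by (intro exI[of _ "PConst 0"]) simp
next
  case (insert s T)
  then obtain u where u: "\<forall>t\<in>T. \<forall>A. LPV (t \<Colon>\<^sub>f A \<rightarrow>\<^sub>f u \<Colon>\<^sub>f A)" "(\<forall>t\<in>T. ground t) \<longrightarrow> ground u"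
    by blast
  have "LPV (t \<Colon>\<^sub>f A \<rightarrow>\<^sub>f Sum s u \<Colon>\<^sub>f A)" if "t \<in> T" for t A
    by (rule LPV_entails2[of "t \<Colon>\<^sub>f A \<rightarrow>\<^sub>f u \<Colon>\<^sub>f A" "u \<Colon>\<^sub>f A \<rightarrow>\<^sub>f Sum s u \<Colon>\<^sub>f A"])
      (use u(1) that in \<open>auto intro: LPV_ax LPV_SumR\<close>)
  moreover have "LPV (s \<Colon>\<^sub>f A \<rightarrow>\<^sub>f Sum s u \<Colon>\<^sub>f A)" for A
    by (intro LPV_ax LPV_SumL)
  ultimately show ?case using u(2) by (intro exI[of _ "Sum s u"]) auto
qed

lemma finite_internalisation:
  assumes "finite S" "\<forall>A\<in>S. LPV A"
  shows "\<exists>u. ground u \<and> (\<forall>A\<in>S. LPV (u \<Colon>\<^sub>f A))"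
proof -
  obtain f where f: "\<And>A. A \<in> S \<Longrightarrow> ground (f A) \<and> LPV (f A \<Colon>\<^sub>f A)"
    using assms(2) internalisation by metis
  obtain u where "\<forall>t\<in>f ` S. \<forall>A. LPV (t \<Colon>\<^sub>f A \<rightarrow>\<^sub>f u \<Colon>\<^sub>f A)" "(\<forall>t\<in>f ` S. ground t) \<longrightarrow> ground u"
    using finite_sum_term[of "f ` S"] assms(1) by blast
  then show ?thesis using f LPV_MP by (intro exI[of _ u]) blast
qed

lemma LPV_Ver_nec: "LPV A \<Longrightarrow> LPV (Ver A)"
  using internalisation LPV_ax LPV_Prf_Ver LPV_MP by blast

lemma LPV_Ver_mono: "LPV (A \<rightarrow>\<^sub>f B) \<Longrightarrow> LPV (Ver A \<rightarrow>\<^sub>f Ver B)"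
  using LPV_Ver_nec LPV_ax LPV_Ver_K LPV_MP by blast

section \<open>The canonical model\<close>

definition world :: "(lpv_fm \<Rightarrow> bool) \<Rightarrow> bool" where
  "world v \<longleftrightarrow> (\<forall>A. LPV A \<longrightarrow> eval v A)"

text \<open>The usual canonical relation, with \<open>Box A\<close> at \<open>v\<close> read as the
  existence of a term proving \<open>A\<close> at \<open>v\<close>.\<close>

definition acc :: "(lpv_fm \<Rightarrow> bool) \<Rightarrow> (lpv_fm \<Rightarrow> bool) \<Rightarrow> bool" where
  "acc v w \<longleftrightarrow> world w \<and> (\<forall>t A. v (t \<Colon>\<^sub>f A) \<longrightarrow> eval w A)"

definition accV :: "(lpv_fm \<Rightarrow> bool) \<Rightarrow> (lpv_fm \<Rightarrow> bool) \<Rightarrow> bool" where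
  "accV v w \<longleftrightarrow> world w \<and> (\<forall>A. v (Ver A) \<longrightarrow> eval w A)"

lemma worldD: "world v \<Longrightarrow> LPV A \<Longrightarrow> eval v A"
  by (simp add: world_def)

lemma world_axiom: "world v \<Longrightarrow> LPV_axiom A \<Longrightarrow> eval v A"
  by (blast intro: worldD LPV_ax)

text \<open>A Lindenbaum-type argument: were the theorems, \<open>S\<close> and the negations of
  \<open>N\<close> jointly unsatisfiable, compactness would leave finitely many of them, which
  amount to a provable \<open>imps As (disjs Bs)\<close>.\<close>

lemma world_extension:
  assumes "\<And>As Bs. set As \<subseteq> S \<Longrightarrow> set Bs \<subseteq> N \<Longrightarrow> \<not> LPV (imps As (disjs Bs))"
  shows "\<exists>w. world w \<and> (\<forall>A\<in>S. eval w A) \<and> (\<forall>B\<in>N. \<not> eval w B)"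
proof -
  have "fin_sat ({A. LPV A} \<union> S \<union> Neg ` N)"
    unfolding fin_sat_def
  proof (intro allI impI, rule ccontr)
    fix T assume T: "finite T" "T \<subseteq> {A. LPV A} \<union> S \<union> Neg ` N"
      and unsat: "\<nexists>v. \<forall>A\<in>T. eval v A"
    obtain Cs where Cs: "set Cs = T \<inter> {A. LPV A}" using T(1) by (metis finite_Int finite_list)
    obtain As where As: "set As = T \<inter> S" using T(1) by (metis finite_Int finite_list)
    have "finite (T \<inter> Neg ` N)" using T(1) by blast
    then obtain N' where N': "N' \<subseteq> N" "finite N'" "T \<inter> Neg ` N = Neg ` N'"
      using finite_subset_image[of "T \<inter> Neg ` N" Neg N] by auto
    obtain Bs where Bs: "set Bs = N'" using finite_list[OF N'(2)] ..
    have "LPV (imps As (disjs Bs))"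
    proof (rule LPV_entails[of Cs])
      fix v assume v: "\<forall>A\<in>set Cs. eval v A"
      show "eval v (imps As (disjs Bs))"
      proof (rule ccontr)
        assume "\<not> ?thesis"
        then have "\<forall>A\<in>T \<inter> S. eval v A" "\<forall>B\<in>T \<inter> Neg ` N. eval v B"
          using As Bs N' by auto
        then have "eval v A" if "A \<in> T" for A
          using that T(2) v Cs by (cases "A \<in> S"; cases "LPV A") auto
        then show False using unsat by blast
      qed
    qed (use Cs in auto)
    moreover have "set As \<subseteq> S" "set Bs \<subseteq> N" using As Bs N' by auto
    ultimately show False using assms by blast
  qed
  then obtain w where "\<forall>A\<in>{A. LPV A} \<union> S \<union> Neg ` N. eval w A" using compactness by blast
  then have "\<forall>A. LPV A \<longrightarrow> eval w A" "\<forall>A\<in>S. eval w A" "\<forall>B\<in>N. eval w (Neg B)" by blast+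
  then show ?thesis by (intro exI[of _ w]) (simp add: world_def)
qed

lemma Prf_imps:
  assumes "world v"
  shows "v (t \<Colon>\<^sub>f imps As B) \<Longrightarrow> \<forall>A\<in>set As. \<exists>s. v (s \<Colon>\<^sub>f A) \<Longrightarrow> \<exists>t. v (t \<Colon>\<^sub>f B)"
proof (induction As arbitrary: t)
  case (Cons A As)
  then obtain s where "v (s \<Colon>\<^sub>f A)" by auto
  then have "v (App t s \<Colon>\<^sub>f imps As B)"
    using Cons.prems(1) world_axiom[OF assms LPV_App[of t A "imps As B" s]] by simp
  then show ?case using Cons by auto
qed auto

lemma Ver_imps:
  assumes "world v"
  shows "v (Ver (imps As B)) \<Longrightarrow> \<forall>A\<in>set As. v (Ver A) \<Longrightarrow> v (Ver B)"
proof (induction As)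
  case (Cons A As)
  then show ?case using world_axiom[OF assms LPV_Ver_K[of A "imps As B"]] by simp
qed auto

text \<open>A derivation of \<open>disjs Bs\<close> from formulas with proofs at \<open>v\<close>
  internalises to a proof of \<open>disjs Bs\<close> at \<open>v\<close>. The argument produces
  disjunctions rather than single formulas, which is why quasi-realisations offer disjunctions under
  positive modalities.\<close>

lemma acc_successor:
  assumes "world v" "\<And>t Bs. set Bs \<subseteq> N \<Longrightarrow> \<not> v (t \<Colon>\<^sub>f disjs Bs)"
  shows "\<exists>w. acc v w \<and> (\<forall>B\<in>N. \<not> eval w B)"
proof -
  have "\<not> LPV (imps As (disjs Bs))" if "set As \<subseteq> {A. \<exists>t. v (t \<Colon>\<^sub>f A)}" "set Bs \<subseteq> N" for As Bs
  proof
    assume "LPV (imps As (disjs Bs))"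
    then obtain t where "LPV (t \<Colon>\<^sub>f imps As (disjs Bs))" using internalisation by blast
    then have "v (t \<Colon>\<^sub>f imps As (disjs Bs))" using worldD[OF assms(1)] by fastforce
    then have "\<exists>t. v (t \<Colon>\<^sub>f disjs Bs)" using Prf_imps[OF assms(1)] that(1) by blast
    then show False using assms(2) that(2) by blast
  qed
  from world_extension[where S = "{A. \<exists>t. v (t \<Colon>\<^sub>f A)}" and N = N, OF this]
  show ?thesis unfolding acc_def by blast
qed

lemma accV_successor:
  assumes "world v" "\<And>Bs. set Bs \<subseteq> N \<Longrightarrow> \<not> v (Ver (disjs Bs))"
  shows "\<exists>w. accV v w \<and> (\<forall>B\<in>N. \<not> eval w B)"
proof -
  have "\<not> LPV (imps As (disjs Bs))" if "set As \<subseteq> {A. v (Ver A)}" "set Bs \<subseteq> N" for As Bs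
  proof
    assume "LPV (imps As (disjs Bs))"
    then have "v (Ver (imps As (disjs Bs)))" using worldD[OF assms(1) LPV_Ver_nec] by fastforce
    then have "v (Ver (disjs Bs))" using Ver_imps[OF assms(1)] that(1) by blast
    then show False using assms(2) that(2) by blast
  qed
  from world_extension[where S = "{A. v (Ver A)}" and N = N, OF this]
  show ?thesis unfolding accV_def by blast
qed

lemma acc_refl: "world v \<Longrightarrow> acc v v"
  using world_axiom[OF _ LPV_Refl] by (auto simp: acc_def)

lemma acc_trans:
  assumes "world v" "acc v w" "acc w u"
  shows "acc v u"
  unfolding acc_def
proof (intro conjI allI impI)
  show "world u" using assms(3) by (simp add: acc_def)
  fix t A assume "v (t \<Colon>\<^sub>f A)"
  then have "v (Bang t \<Colon>\<^sub>f t \<Colon>\<^sub>f A)" using world_axiom[OF assms(1) LPV_Bang[of t A]] by simp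
  then have "w (t \<Colon>\<^sub>f A)" using assms(2) unfolding acc_def by fastforce
  then show "eval u A" using assms(3) by (auto simp: acc_def)
qed

lemma accV_imp_acc: "world v \<Longrightarrow> accV v w \<Longrightarrow> acc v w"
  using world_axiom[OF _ LPV_Prf_Ver] by (fastforce simp: acc_def accV_def)

text \<open>The frame condition for \<open>Neg (Box (Ver Bot))\<close>: \<open>LPV_cons\<close> lets
  some successor refute \<open>Ver Bot\<close>, and such a world has an
  \<open>accV\<close>-successor.\<close>

lemma acc_accV_serial:
  assumes "world v"
  shows "\<exists>w u. acc v w \<and> accV w u"
proof -
  have "\<not> v (t \<Colon>\<^sub>f disjs Bs)" if "set Bs \<subseteq> {Ver Bot}" for t Bs
  proof
    assume t: "v (t \<Colon>\<^sub>f disjs Bs)"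
    \<comment> \<open>All entries of \<open>Bs\<close> are \<open>Ver Bot\<close>, so its
      disjunction implies \<open>Ver Bot\<close>, and application would prove \<open>Ver Bot\<close>
      at \<open>v\<close>.\<close>
    have "LPV (disjs Bs \<rightarrow>\<^sub>f Ver Bot)" by (rule LPV_tautology) (use that in auto)
    then obtain s where "LPV (s \<Colon>\<^sub>f (disjs Bs \<rightarrow>\<^sub>f Ver Bot))" using internalisation by blast
    then have "v (App s t \<Colon>\<^sub>f Ver Bot)" using worldD[OF assms LPV_App_MP] t by fastforce
    then show False using world_axiom[OF assms LPV_cons] by simp
  qed
  from acc_successor[where N = "{Ver Bot}", OF assms this] obtain w where w: "acc v w" "\<not> w (Ver Bot)" by auto
  then have "world w" by (simp add: acc_def)
  \<comment> \<open>With \<open>N\<close> empty, the only disjunction to exclude is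
    \<open>Bot\<close>.\<close>
  from accV_successor[OF this, of "{}"] w show ?thesis by auto
qed

section \<open>Kripke semantics and soundness of S4V\<close>

fun sat :: "(lpv_fm \<Rightarrow> bool) \<Rightarrow> s4v_fm \<Rightarrow> bool" where
  "sat v (Atom n) \<longleftrightarrow> v (Atom n)"
| "sat v Bot \<longleftrightarrow> False"
| "sat v (Neg A) \<longleftrightarrow> \<not> sat v A"
| "sat v (Con A B) \<longleftrightarrow> sat v A \<and> sat v B"
| "sat v (Dis A B) \<longleftrightarrow> sat v A \<or> sat v B"
| "sat v (A \<rightarrow>\<^sub>f B) \<longleftrightarrow> (sat v A \<longrightarrow> sat v B)"
| "sat v (Ver A) \<longleftrightarrow> (\<forall>w. accV v w \<longrightarrow> sat w A)"
| "sat v (Box A) \<longleftrightarrow> (\<forall>w. acc v w \<longrightarrow> sat w A)"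

lemma eval_sat: "eval (sat v) A \<longleftrightarrow> sat v A"
  by (induction A) auto

lemma S4V_axiom_sound: "S4V_axiom A \<Longrightarrow> world v \<Longrightarrow> sat v A"
proof (induction rule: S4V_axiom.induct)
  case (S4V_taut A)
  then show ?case using eval_sat by (auto simp: tautology_def)
next
  case S4V_cons
  then show ?case using acc_accV_serial by auto
qed (auto intro: acc_refl acc_trans accV_imp_acc)

lemma S4V_sound: "S4V A \<Longrightarrow> world v \<Longrightarrow> sat v A"
proof (induction arbitrary: v rule: S4V.induct)
  case (S4V_ax A)
  then show ?case by (simp add: S4V_axiom_sound)
qed (auto simp: acc_def)

section \<open>Quasi-realisations\<close>

text \<open>In \<open>qreal s e A\<close> the flag \<open>s\<close> is the polarity of \<open>A\<close>; the negative box at path \<open>p\<close>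
  is realised by the variable \<open>e p\<close>, while under positive modalities finite disjunctions
  of alternatives are allowed.\<close>

fun qreal :: "bool \<Rightarrow> (path \<Rightarrow> nat) \<Rightarrow> s4v_fm \<Rightarrow> lpv_fm set" where
  "qreal s e (Atom n) = {Atom n}"
| "qreal s e Bot = {Bot}"
| "qreal s e (Neg A) = Neg ` qreal (\<not> s) (\<lambda>p. e (0 # p)) A"
| "qreal s e (Con A B) =
    case_prod Con ` (qreal s (\<lambda>p. e (0 # p)) A \<times> qreal s (\<lambda>p. e (1 # p)) B)"
| "qreal s e (Dis A B) =
    case_prod Dis ` (qreal s (\<lambda>p. e (0 # p)) A \<times> qreal s (\<lambda>p. e (1 # p)) B)"
| "qreal s e (A \<rightarrow>\<^sub>f B) =
    case_prod Imp ` (qreal (\<not> s) (\<lambda>p. e (0 # p)) A \<times> qreal s (\<lambda>p. e (1 # p)) B)"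
| "qreal s e (Ver A) =
    (if s then (\<lambda>As. Ver (disjs As)) ` lists (qreal s (\<lambda>p. e (0 # p)) A)
     else Ver ` qreal s (\<lambda>p. e (0 # p)) A)"
| "qreal s e (Box A) =
    (if s then (\<lambda>(t, As). t \<Colon>\<^sub>f disjs As) ` (UNIV \<times> lists (qreal s (\<lambda>p. e (0 # p)) A))
     else Mod (PVar (e [])) ` qreal s (\<lambda>p. e (0 # p)) A)"

text \<open>A fact about all compound quasi-realisations passes to one component only if the other
  component has some quasi-realisation to pair with.\<close>

lemma qreal_nonempty: "qreal s e A \<noteq> {}"
proof (induction s e A rule: qreal.induct)
  case (7 s e A)
  have "lists (qreal s (\<lambda>p. e (0 # p)) A) \<noteq> {}" by (metis empty_iff lists.Nil)
  then show ?case using 7 by (cases s) simp_all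
next
  case (8 s e A)
  have "lists (qreal s (\<lambda>p. e (0 # p)) A) \<noteq> {}" by (metis empty_iff lists.Nil)
  then show ?case using 8 by (cases s) simp_all
qed simp_all

text \<open>The form \<open>\<noteq> s\<close> treats both polarities at once: false for positive
  formulas, true for negative ones. Positive modalities use the successor lemmas. At a negative box,
  \<open>PVar (e [])\<close> proves each alternative at \<open>v\<close>, so each holds at all
  successors.\<close>

lemma qreal_truth:
  assumes "world v" "\<forall>X\<in>qreal s e A. eval v X \<noteq> s"
  shows "sat v A \<noteq> s"
  using assms
proof (induction s e A arbitrary: v rule: qreal.induct)
  case (3 s e A)
  then show ?case by auto
next
  case (4 s e A B)
  \<comment> \<open>If all conjunctions are true, so are all components. If all are false, one side
    is uniformly false, since otherwise a true choice on each side would combine.\<close>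
  have "(\<forall>X\<in>qreal s (\<lambda>p. e (0 # p)) A. eval v X \<noteq> s) \<and> (\<forall>X\<in>qreal s (\<lambda>p. e (1 # p)) B. eval v X \<noteq> s)"
    if "\<not> s"
    using 4(4) that qreal_nonempty[of s] by fastforce
  moreover have "(\<forall>X\<in>qreal s (\<lambda>p. e (0 # p)) A. eval v X \<noteq> s) \<or> (\<forall>X\<in>qreal s (\<lambda>p. e (1 # p)) B. eval v X \<noteq> s)"
    if s
    using 4(4) that by fastforce
  ultimately show ?case using 4(1,2)[OF 4(3)] by (cases s) auto
next
  case (5 s e A B)
  have "(\<forall>X\<in>qreal s (\<lambda>p. e (0 # p)) A. eval v X \<noteq> s) \<and> (\<forall>X\<in>qreal s (\<lambda>p. e (1 # p)) B. eval v X \<noteq> s)"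
    if s
    using 5(4) that qreal_nonempty[of s] by fastforce
  moreover have "(\<forall>X\<in>qreal s (\<lambda>p. e (0 # p)) A. eval v X \<noteq> s) \<or> (\<forall>X\<in>qreal s (\<lambda>p. e (1 # p)) B. eval v X \<noteq> s)"
    if "\<not> s"
    using 5(4) that by fastforce
  ultimately show ?case using 5(1,2)[OF 5(3)] by (cases s) auto
next
  case (6 s e A B)
  have "(\<forall>X\<in>qreal (\<not> s) (\<lambda>p. e (0 # p)) A. eval v X \<noteq> (\<not> s)) \<and> (\<forall>X\<in>qreal s (\<lambda>p. e (1 # p)) B. eval v X \<noteq> s)"
    if s
    using 6(4) that qreal_nonempty by fastforce
  moreover have "(\<forall>X\<in>qreal (\<not> s) (\<lambda>p. e (0 # p)) A. eval v X \<noteq> (\<not> s)) \<or> (\<forall>X\<in>qreal s (\<lambda>p. e (1 # p)) B. eval v X \<noteq> s)"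
    if "\<not> s"
    using 6(4) that by fastforce
  ultimately show ?case using 6(1,2)[OF 6(3)] by (cases s) auto
next
  case (7 s e A)
  show ?case
  proof (cases s)
    case True
    then have "\<not> v (Ver (disjs Bs))" if "set Bs \<subseteq> qreal s (\<lambda>p. e (0 # p)) A" for Bs
      using 7(4) that by (auto simp: lists_eq_set)
    from accV_successor[where N = "qreal s (\<lambda>p. e (0 # p)) A", OF 7(3) this] obtain w
      where "accV v w" "\<forall>B\<in>qreal s (\<lambda>p. e (0 # p)) A. \<not> eval w B" by blast
    then show ?thesis using 7(1) True by (auto simp: accV_def)
  next
    case False
    then show ?thesis using 7(2,4) by (auto simp: accV_def)
  qed
next
  case (8 s e A)
  show ?case
  proof (cases s)
    case True
    then have "\<not> v (t \<Colon>\<^sub>f disjs Bs)" if "set Bs \<subseteq> qreal s (\<lambda>p. e (0 # p)) A" for t Bs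
      using 8(4) that by (fastforce simp: lists_eq_set)
    from acc_successor[where N = "qreal s (\<lambda>p. e (0 # p)) A", OF 8(3) this] obtain w
      where "acc v w" "\<forall>B\<in>qreal s (\<lambda>p. e (0 # p)) A. \<not> eval w B" by blast
    then show ?thesis using 8(1) True by (auto simp: acc_def)
  next
    case False
    have "sat w A" if "acc v w" for w
    proof -
      have "\<forall>X\<in>qreal s (\<lambda>p. e (0 # p)) A. eval w X"
        using 8(4) False that unfolding acc_def by simp blast
      then show ?thesis using 8(2)[OF False] False that by (auto simp: acc_def)
    qed
    then show ?thesis using False by simp
  qed
qed auto

lemma S4V_quasi_realisation:
  assumes "S4V F"
  shows "\<exists>Bs. set Bs \<subseteq> qreal True e F \<and> LPV (disjs Bs)"
proof (rule ccontr)
  assume "\<not> ?thesis"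
  \<comment> \<open>With no premises, \<open>imps As (disjs Bs)\<close> is \<open>disjs Bs\<close>
    itself.\<close>
  then have "\<not> LPV (imps As (disjs Bs))" if "set As \<subseteq> {}" "set Bs \<subseteq> qreal True e F" for As Bs
    using that by auto
  from world_extension[where S = "{}" and N = "qreal True e F", OF this]
  obtain w where "world w" "\<forall>B\<in>qreal True e F. \<not> eval w B"
    by blast
  then show False using qreal_truth[of w True e F] S4V_sound[OF assms] by auto
qed

section \<open>Condensing quasi-realisations\<close>

text \<open>The final realisation puts the single variable \<open>PVar 0\<close> at all negative boxes, so \<open>0\<close> is kept
  out of the domains and every substitution fixes it. Hence substitutions with disjoint domains
  commute, which allows those obtained from different subformulas to be merged.\<close>

definition ground_subst :: "(nat \<Rightarrow> tm) \<Rightarrow> nat set \<Rightarrow> bool" where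
  "ground_subst \<sigma> D \<longleftrightarrow>
    (\<forall>n. \<sigma> n = PVar n \<or> n \<noteq> 0 \<and> n \<in> D \<and> (\<exists>t. ground t \<and> \<sigma> n = App t (PVar 0)))"

lemma ground_subst_PVar: "ground_subst PVar D"
  by (simp add: ground_subst_def)

lemma ground_subst_0: "ground_subst \<sigma> D \<Longrightarrow> \<sigma> 0 = PVar 0"
  by (auto simp: ground_subst_def)

lemma ground_subst_outside: "ground_subst \<sigma> D \<Longrightarrow> n \<notin> D \<Longrightarrow> \<sigma> n = PVar n"
  by (auto simp: ground_subst_def)

lemma ground_subst_mono: "ground_subst \<sigma> D \<Longrightarrow> D \<subseteq> D' \<Longrightarrow> ground_subst \<sigma> D'"
  by (fastforce simp: ground_subst_def)

text \<open>On \<open>D\<close> the substitution \<open>\<tau>\<close> is the identity. Off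
  \<open>D\<close> its value at \<open>n\<close> contains no variables besides \<open>n\<close> and
  \<open>0\<close>, and \<open>\<sigma>\<close> fixes both.\<close>

lemma ground_subst_comp:
  assumes "ground_subst \<sigma> D" "ground_subst \<tau> D'" "D \<inter> D' = {}"
  shows "tsub \<sigma> (\<tau> n) = (if n \<in> D then \<sigma> n else \<tau> n)"
proof (cases "n \<in> D")
  case True
  then have "\<tau> n = PVar n" using assms(2,3) by (auto intro: ground_subst_outside)
  then show ?thesis using True by simp
next
  case False
  consider "\<tau> n = PVar n" | t where "ground t" "\<tau> n = App t (PVar 0)"
    using assms(2) by (auto simp: ground_subst_def)
  then show ?thesis
    using False ground_subst_outside[OF assms(1)] ground_subst_0[OF assms(1)] by cases auto
qed

lemma ground_subst_union:
  assumes "ground_subst \<sigma> D" "ground_subst \<tau> D'"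
  shows "ground_subst (\<lambda>n. if n \<in> D then \<sigma> n else \<tau> n) (D \<union> D')"
  using assms by (auto simp: ground_subst_def)

lemma realise_tsub: "realise (\<lambda>p. tsub \<sigma> (r p)) A = fsub \<sigma> (realise r A)"
  by (induction r A rule: realise.induct) auto

text \<open>Condensing may weaken a positive formula and strengthen a negative one; either way the
  whole formula is only weakened.\<close>

definition directed_imp :: "bool \<Rightarrow> lpv_fm \<Rightarrow> lpv_fm \<Rightarrow> lpv_fm" where
  "directed_imp s X Y = (if s then X \<rightarrow>\<^sub>f Y else Y \<rightarrow>\<^sub>f X)"

text \<open>\<open>box_occs (\<not> s) A\<close> collects the boxes that are negative in the whole
  formula when \<open>A\<close> stands in it with polarity \<open>s\<close>. The substitution acts
  on the quasi-realisations, while \<open>r\<close> already carries the resulting terms.\<close>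

definition condenses ::
  "bool \<Rightarrow> s4v_fm \<Rightarrow> lpv_fm set \<Rightarrow> realisation \<Rightarrow> (nat \<Rightarrow> tm) \<Rightarrow> bool" where
  "condenses s A S r \<sigma> \<longleftrightarrow>
    (\<forall>p\<in>box_occs (\<not> s) A. r p = PVar 0) \<and>
    (\<forall>X\<in>S. LPV (directed_imp s (fsub \<sigma> X) (realise r A)))"

lemma condenses_comp:
  assumes "condenses s A S r \<sigma>" "\<tau> 0 = PVar 0"
  shows "condenses s A S (\<lambda>p. tsub \<tau> (r p)) (\<lambda>n. tsub \<tau> (\<sigma> n))"
proof -
  have "LPV (directed_imp s (fsub (\<lambda>n. tsub \<tau> (\<sigma> n)) X) (realise (\<lambda>p. tsub \<tau> (r p)) A))"
    if "X \<in> S" for X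
    using assms(1) that LPV_fsub[of "directed_imp s (fsub \<sigma> X) (realise r A)" \<tau>]
    by (auto simp: condenses_def directed_imp_def realise_tsub fsub_fsub)
  then show ?thesis using assms by (auto simp: condenses_def)
qed

text \<open>Each side is composed with the substitution of the other. Disjoint domains make the two
  composites equal, so one substitution serves both sides.\<close>

lemma condenses_pair:
  assumes "condenses s A S r \<sigma>" "ground_subst \<sigma> D"
    and "condenses s' A' S' r' \<sigma>'" "ground_subst \<sigma>' D'"
    and "D \<inter> D' = {}"
  shows "\<exists>r r' \<sigma>. condenses s A S r \<sigma> \<and> condenses s' A' S' r' \<sigma> \<and> ground_subst \<sigma> (D \<union> D')"
proof -
  let ?\<tau> = "\<lambda>n. if n \<in> D then \<sigma> n else \<sigma>' n"
  have "tsub \<sigma> (\<sigma>' n) = ?\<tau> n" for n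
    using ground_subst_comp[OF assms(2,4,5)] .
  moreover have "tsub \<sigma>' (\<sigma> n) = ?\<tau> n" for n
    using ground_subst_comp[OF assms(4,2), of n] assms(5) ground_subst_outside[OF assms(2), of n]
      ground_subst_outside[OF assms(4), of n] by (auto simp: Int_commute)
  ultimately show ?thesis
    using condenses_comp[OF assms(1), of \<sigma>'] condenses_comp[OF assms(3), of \<sigma>]
      ground_subst_0[OF assms(2)] ground_subst_0[OF assms(4)]
      ground_subst_union[OF assms(2,4)] by auto
qed

section \<open>Condensing by induction on the formula\<close>

fun join :: "tm \<Rightarrow> realisation \<Rightarrow> realisation \<Rightarrow> realisation" where
  "join t r r' [] = t"
| "join t r r' (i # p) = (if i = 0 then r p else r' p)"

text \<open>Passing from the pairs in use to the product of their projections allows the two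
  components to be condensed separately.\<close>

lemma finite_subset_image_Times:
  assumes "finite S" "S \<subseteq> f ` (P \<times> Q)"
  shows "\<exists>S1 S2. finite S1 \<and> S1 \<subseteq> P \<and> finite S2 \<and> S2 \<subseteq> Q \<and> S \<subseteq> f ` (S1 \<times> S2)"
proof -
  obtain C where C: "C \<subseteq> P \<times> Q" "finite C" "S = f ` C"
    using finite_subset_image[OF assms] by blast
  have "C \<subseteq> fst ` C \<times> snd ` C" by force
  then have "S \<subseteq> f ` (fst ` C \<times> snd ` C)" unfolding C(3) by (rule image_mono)
  moreover have "fst ` C \<subseteq> P" "snd ` C \<subseteq> Q" using C(1) by auto
  ultimately show ?thesis using C(2) by blast
qed

lemma inj_child: "inj e \<Longrightarrow> inj (\<lambda>p. e (i # p))"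
  by (auto simp: inj_def)

lemma range_child_disjoint:
  fixes e :: "path \<Rightarrow> 'a"
  shows "inj e \<Longrightarrow> range (\<lambda>p. e (0 # p)) \<inter> range (\<lambda>p. e (1 # p)) = {}"
  by (auto simp: inj_eq)

lemma range_child: "range (\<lambda>p. e (i # p)) \<subseteq> range e"
  by auto

text \<open>Shared by \<open>Con\<close>, \<open>Dis\<close> and \<open>Imp\<close>; the polarities
  \<open>s1\<close> and \<open>s2\<close> are separate because \<open>Imp\<close> reverses that of
  its left argument.\<close>

lemma condense_binary:
  fixes e :: "path \<Rightarrow> nat"
  assumes IH1: "\<And>S. finite S \<Longrightarrow> S \<subseteq> P \<Longrightarrow> inj (\<lambda>p. e (0 # p)) \<Longrightarrow>
      \<exists>r \<sigma>. condenses s1 A S r \<sigma> \<and> ground_subst \<sigma> (range (\<lambda>p. e (0 # p)))"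
    and IH2: "\<And>S. finite S \<Longrightarrow> S \<subseteq> Q \<Longrightarrow> inj (\<lambda>p. e (1 # p)) \<Longrightarrow>
      \<exists>r \<sigma>. condenses s2 B S r \<sigma> \<and> ground_subst \<sigma> (range (\<lambda>p. e (1 # p)))"
    and e: "inj e" and S: "finite S" "S \<subseteq> case_prod f ` (P \<times> Q)"
  shows "\<exists>r1 r2 S1 S2 \<sigma>. condenses s1 A S1 r1 \<sigma> \<and> condenses s2 B S2 r2 \<sigma> \<and>
    S \<subseteq> case_prod f ` (S1 \<times> S2) \<and> ground_subst \<sigma> (range e)"
proof -
  obtain S1 S2 where S12: "finite S1" "S1 \<subseteq> P" "finite S2" "S2 \<subseteq> Q" "S \<subseteq> case_prod f ` (S1 \<times> S2)"
    using finite_subset_image_Times[OF S] by blast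
  obtain r1 \<sigma>1 where 1: "condenses s1 A S1 r1 \<sigma>1" "ground_subst \<sigma>1 (range (\<lambda>p. e (0 # p)))"
    using IH1[OF S12(1,2)] inj_child[OF e] by blast
  obtain r2 \<sigma>2 where 2: "condenses s2 B S2 r2 \<sigma>2" "ground_subst \<sigma>2 (range (\<lambda>p. e (1 # p)))"
    using IH2[OF S12(3,4)] inj_child[OF e] by blast
  obtain r r' \<sigma> where \<sigma>: "condenses s1 A S1 r \<sigma>" "condenses s2 B S2 r' \<sigma>"
    and g: "ground_subst \<sigma> (range (\<lambda>p. e (0 # p)) \<union> range (\<lambda>p. e (1 # p)))"
    using condenses_pair[OF 1 2 range_child_disjoint[OF e]] by blast
  have "ground_subst \<sigma> (range e)" by (rule ground_subst_mono[OF g]) auto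
  then show ?thesis using \<sigma> S12(5) by blast
qed

lemma LPV_disj_imp:
  assumes "\<forall>X\<in>set As. LPV (X \<rightarrow>\<^sub>f B)"
  shows "LPV (disjs As \<rightarrow>\<^sub>f B)"
  by (rule LPV_entails[of "map (\<lambda>X. X \<rightarrow>\<^sub>f B) As"]) (use assms in auto)

text \<open>Compound terms are built at positive boxes and new substitution values at negative ones;
  the rest is propositional reasoning and monotonicity of \<open>Ver\<close>. Injectivity of
  \<open>e\<close> keeps the domains of siblings, and of a box and its body, disjoint.\<close>

lemma condense:
  assumes "finite S" "S \<subseteq> qreal s e A" "inj e" "0 \<notin> range e"
  shows "\<exists>r \<sigma>. condenses s A S r \<sigma> \<and> ground_subst \<sigma> (range e)"
  using assms
proof (induction s e A arbitrary: S rule: qreal.induct)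
  case (1 s e n)
  then show ?case
    by (intro exI[of _ "\<lambda>_. PVar 0"] exI[of _ PVar])
      (auto simp: condenses_def directed_imp_def ground_subst_PVar intro!: LPV_tautology)
next
  case (2 s e)
  then show ?case
    by (intro exI[of _ "\<lambda>_. PVar 0"] exI[of _ PVar])
      (auto simp: condenses_def directed_imp_def ground_subst_PVar intro!: LPV_tautology)
next
  case (3 s e A)
  have "S \<subseteq> Neg ` qreal (\<not> s) (\<lambda>p. e (0 # p)) A" using 3(3) by simp
  then obtain S1 where S1: "S1 \<subseteq> qreal (\<not> s) (\<lambda>p. e (0 # p)) A" "finite S1" "S = Neg ` S1"
    using finite_subset_image[OF 3(2)] by blast
  have "0 \<notin> range (\<lambda>p. e (0 # p))" using 3(5) by auto
  then obtain r \<sigma> where c: "condenses (\<not> s) A S1 r \<sigma>" and g: "ground_subst \<sigma> (range (\<lambda>p. e (0 # p)))"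
    using 3(1)[OF S1(2,1) inj_child[OF 3(4)]] by blast
  have "LPV (directed_imp s (fsub \<sigma> (Neg X)) (Neg (realise r A)))" if "X \<in> S1" for X
    using c that by (auto simp: condenses_def directed_imp_def elim!: LPV_entails1)
  \<comment> \<open>The root value \<open>PVar 0\<close> is a filler, as a negation has no box at
    its root.\<close>
  then have "condenses s (Neg A) S (join (PVar 0) r r) \<sigma>"
    using c S1(3) by (auto simp: condenses_def)
  then show ?case using ground_subst_mono[OF g range_child] by blast
next
  case (4 s e A B)
  have z: "0 \<notin> range (\<lambda>p. e (0 # p))" "0 \<notin> range (\<lambda>p. e (1 # p))" using 4(6) by auto
  obtain r1 r2 S1 S2 \<sigma> where c: "condenses s A S1 r1 \<sigma>" "condenses s B S2 r2 \<sigma>"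
      "S \<subseteq> case_prod Con ` (S1 \<times> S2)" and g: "ground_subst \<sigma> (range e)"
    using condense_binary[OF 4(1)[OF _ _ _ z(1)] 4(2)[OF _ _ _ z(2)] 4(5,3) 4(4)[unfolded qreal.simps]]
    by blast
  have "LPV (directed_imp s (fsub \<sigma> (Con X Y)) (Con (realise r1 A) (realise r2 B)))"
    if "X \<in> S1" "Y \<in> S2" for X Y
    by (rule LPV_entails2[of "directed_imp s (fsub \<sigma> X) (realise r1 A)"
          "directed_imp s (fsub \<sigma> Y) (realise r2 B)"])
      (use c that in \<open>auto simp: condenses_def directed_imp_def split: if_splits\<close>)
  then have "condenses s (Con A B) S (join (PVar 0) r1 r2) \<sigma>"
    using c by (auto simp: condenses_def)
  then show ?case using g by blast
next
  case (5 s e A B)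
  have z: "0 \<notin> range (\<lambda>p. e (0 # p))" "0 \<notin> range (\<lambda>p. e (1 # p))" using 5(6) by auto
  obtain r1 r2 S1 S2 \<sigma> where c: "condenses s A S1 r1 \<sigma>" "condenses s B S2 r2 \<sigma>"
      "S \<subseteq> case_prod Dis ` (S1 \<times> S2)" and g: "ground_subst \<sigma> (range e)"
    using condense_binary[OF 5(1)[OF _ _ _ z(1)] 5(2)[OF _ _ _ z(2)] 5(5,3) 5(4)[unfolded qreal.simps]]
    by blast
  have "LPV (directed_imp s (fsub \<sigma> (Dis X Y)) (Dis (realise r1 A) (realise r2 B)))"
    if "X \<in> S1" "Y \<in> S2" for X Y
    by (rule LPV_entails2[of "directed_imp s (fsub \<sigma> X) (realise r1 A)"
          "directed_imp s (fsub \<sigma> Y) (realise r2 B)"])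
      (use c that in \<open>auto simp: condenses_def directed_imp_def split: if_splits\<close>)
  then have "condenses s (Dis A B) S (join (PVar 0) r1 r2) \<sigma>"
    using c by (auto simp: condenses_def)
  then show ?case using g by blast
next
  case (6 s e A B)
  have z: "0 \<notin> range (\<lambda>p. e (0 # p))" "0 \<notin> range (\<lambda>p. e (1 # p))" using 6(6) by auto
  obtain r1 r2 S1 S2 \<sigma> where c: "condenses (\<not> s) A S1 r1 \<sigma>" "condenses s B S2 r2 \<sigma>"
      "S \<subseteq> case_prod Imp ` (S1 \<times> S2)" and g: "ground_subst \<sigma> (range e)"
    using condense_binary[OF 6(1)[OF _ _ _ z(1)] 6(2)[OF _ _ _ z(2)] 6(5,3) 6(4)[unfolded qreal.simps]]
    by blast
  have "LPV (directed_imp s (fsub \<sigma> (X \<rightarrow>\<^sub>f Y)) (realise r1 A \<rightarrow>\<^sub>f realise r2 B))"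
    if "X \<in> S1" "Y \<in> S2" for X Y
    by (rule LPV_entails2[of "directed_imp (\<not> s) (fsub \<sigma> X) (realise r1 A)"
          "directed_imp s (fsub \<sigma> Y) (realise r2 B)"])
      (use c that in \<open>auto simp: condenses_def directed_imp_def split: if_splits\<close>)
  then have "condenses s (A \<rightarrow>\<^sub>f B) S (join (PVar 0) r1 r2) \<sigma>"
    using c by (auto simp: condenses_def)
  then show ?case using g by blast
next
  case (7 s e A)
  have z: "0 \<notin> range (\<lambda>p. e (0 # p))" using 7(6) by auto
  show ?case
  proof (cases s)
    case True
    have "S \<subseteq> (\<lambda>As. Ver (disjs As)) ` lists (qreal s (\<lambda>p. e (0 # p)) A)"
      using 7(4) True by simp
    from finite_subset_image[OF 7(3) this] obtain L where L: "L \<subseteq> lists (qreal s (\<lambda>p. e (0 # p)) A)" "finite L"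
        "S = (\<lambda>As. Ver (disjs As)) ` L"
      by (elim exE conjE)
    \<comment> \<open>The alternatives from all lists are condensed together, so every disjunction
      implies the same realisation.\<close>
    have "finite (\<Union>(set ` L))" "\<Union>(set ` L) \<subseteq> qreal s (\<lambda>p. e (0 # p)) A"
      using L(1,2) by auto
    then obtain r \<sigma> where c: "condenses s A (\<Union>(set ` L)) r \<sigma>"
        and g: "ground_subst \<sigma> (range (\<lambda>p. e (0 # p)))"
      using 7(1)[OF True _ _ inj_child[OF 7(5)] z] by blast
    have "LPV (Ver (fsub \<sigma> (disjs As)) \<rightarrow>\<^sub>f Ver (realise r A))" if "As \<in> L" for As
      unfolding map_fm_disjs
      by (rule LPV_Ver_mono, rule LPV_disj_imp)
        (use c that True in \<open>auto simp: condenses_def directed_imp_def\<close>)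
    then have "condenses s (Ver A) S (join (PVar 0) r r) \<sigma>"
      using c L(3) True by (auto simp: condenses_def directed_imp_def)
    then show ?thesis using ground_subst_mono[OF g range_child] by blast
  next
    case False
    have "S \<subseteq> Ver ` qreal s (\<lambda>p. e (0 # p)) A" using 7(4) False by simp
    then obtain S1 where S1: "S1 \<subseteq> qreal s (\<lambda>p. e (0 # p)) A" "finite S1" "S = Ver ` S1"
      using finite_subset_image[OF 7(3)] by blast
    obtain r \<sigma> where c: "condenses s A S1 r \<sigma>" and g: "ground_subst \<sigma> (range (\<lambda>p. e (0 # p)))"
      using 7(2)[OF False S1(2,1) inj_child[OF 7(5)] z] by blast
    have "condenses s (Ver A) S (join (PVar 0) r r) \<sigma>"
      using c S1(3) False by (auto simp: condenses_def directed_imp_def intro: LPV_Ver_mono)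
    then show ?thesis using ground_subst_mono[OF g range_child] by blast
  qed
next
  case (8 s e A)
  have z: "0 \<notin> range (\<lambda>p. e (0 # p))" using 8(6) by auto
  show ?case
  proof (cases s)
    case True
    have "S \<subseteq> (\<lambda>(t, As). t \<Colon>\<^sub>f disjs As) ` (UNIV \<times> lists (qreal s (\<lambda>p. e (0 # p)) A))"
      using 8(4) True by simp
    from finite_subset_image_Times[OF 8(3) this] obtain T L where L: "finite T" "finite L" "L \<subseteq> lists (qreal s (\<lambda>p. e (0 # p)) A)"
        "S \<subseteq> (\<lambda>(t, As). t \<Colon>\<^sub>f disjs As) ` (T \<times> L)"
      by (elim exE conjE)
    have "finite (\<Union>(set ` L))" "\<Union>(set ` L) \<subseteq> qreal s (\<lambda>p. e (0 # p)) A"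
      using L(2,3) by auto
    then obtain r \<sigma> where c: "condenses s A (\<Union>(set ` L)) r \<sigma>"
        and g: "ground_subst \<sigma> (range (\<lambda>p. e (0 # p)))"
      using 8(1)[OF True _ _ inj_child[OF 8(5)] z] by blast
    have "LPV (fsub \<sigma> (disjs As) \<rightarrow>\<^sub>f realise r A)" if "As \<in> L" for As
      unfolding map_fm_disjs
      by (rule LPV_disj_imp) (use c that True in \<open>auto simp: condenses_def directed_imp_def\<close>)
    \<comment> \<open>A proof \<open>t\<close> of a disjunction becomes the proof
      \<open>App u (tsub \<sigma> t)\<close> of \<open>realise r A\<close>; \<open>q\<close> then
      sums these over the finitely many \<open>t\<close>.\<close>
    then obtain u where u: "\<And>As. As \<in> L \<Longrightarrow> LPV (u \<Colon>\<^sub>f (fsub \<sigma> (disjs As) \<rightarrow>\<^sub>f realise r A))"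
      using finite_internalisation[of "(\<lambda>As. fsub \<sigma> (disjs As) \<rightarrow>\<^sub>f realise r A) ` L"] L(2) by auto
    obtain q where q: "\<forall>t\<in>(\<lambda>t. App u (tsub \<sigma> t)) ` T. \<forall>X. LPV (t \<Colon>\<^sub>f X \<rightarrow>\<^sub>f q \<Colon>\<^sub>f X)"
      using finite_sum_term[of "(\<lambda>t. App u (tsub \<sigma> t)) ` T"] L(1) by blast
    have "LPV (fsub \<sigma> (t \<Colon>\<^sub>f disjs As) \<rightarrow>\<^sub>f q \<Colon>\<^sub>f realise r A)" if "t \<in> T" "As \<in> L" for t As
      by (rule LPV_entails2[OF LPV_App_MP[OF u[OF that(2)], of "tsub \<sigma> t"]
            q[rule_format, OF imageI[OF that(1)], of "realise r A"]]) simp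
    then have "condenses s (Box A) S (join q r r) \<sigma>"
      using c L(4) True by (fastforce simp: condenses_def directed_imp_def)
    then show ?thesis using ground_subst_mono[OF g range_child] by blast
  next
    case False
    have "S \<subseteq> Mod (PVar (e [])) ` qreal s (\<lambda>p. e (0 # p)) A" using 8(4) False by simp
    then obtain S1 where S1: "S1 \<subseteq> qreal s (\<lambda>p. e (0 # p)) A" "finite S1"
        "S = Mod (PVar (e [])) ` S1"
      using finite_subset_image[OF 8(3)] by blast
    obtain r \<sigma> where c: "condenses s A S1 r \<sigma>" and g: "ground_subst \<sigma> (range (\<lambda>p. e (0 # p)))"
      using 8(2)[OF False S1(2,1) inj_child[OF 8(5)] z] by blast
    have "LPV (realise r A \<rightarrow>\<^sub>f fsub \<sigma> X)" if "X \<in> S1" for X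
      using c that False by (auto simp: condenses_def directed_imp_def)
    then obtain u where u: "ground u" "\<And>X. X \<in> S1 \<Longrightarrow> LPV (u \<Colon>\<^sub>f (realise r A \<rightarrow>\<^sub>f fsub \<sigma> X))"
      using finite_internalisation[of "(\<lambda>X. realise r A \<rightarrow>\<^sub>f fsub \<sigma> X) ` S1"] S1(2) by auto
    \<comment> \<open>If \<open>PVar 0\<close> proves the realised body, then
      \<open>App u (PVar 0)\<close> proves each substituted alternative; hence this value for the
      variable \<open>e []\<close> of the box.\<close>
    define \<tau> where "\<tau> = PVar(e [] := App u (PVar 0))"
    have e0: "e [] \<noteq> 0" using 8(6) by (metis rangeI)
    have fresh: "{e []} \<inter> range (\<lambda>p. e (0 # p)) = {}" using 8(5) by (auto simp: inj_def)
    have \<tau>: "ground_subst \<tau> {e []}" using u(1) e0 by (auto simp: ground_subst_def \<tau>_def)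
    let ?\<rho> = "\<lambda>n. tsub \<tau> (\<sigma> n)"
    let ?r = "\<lambda>p. tsub \<tau> (r p)"
    have c': "condenses s A S1 ?r ?\<rho>" using c ground_subst_0[OF \<tau>] by (rule condenses_comp)
    have "ground_subst ?\<rho> ({e []} \<union> range (\<lambda>p. e (0 # p)))"
      using ground_subst_union[OF \<tau> g] ground_subst_comp[OF \<tau> g fresh] by simp
    then have g': "ground_subst ?\<rho> (range e)" by (rule ground_subst_mono) auto
    have \<rho>: "?\<rho> (e []) = App u (PVar 0)"
      using ground_subst_comp[OF \<tau> g fresh] by (simp add: \<tau>_def)
    have "LPV (PVar 0 \<Colon>\<^sub>f realise ?r A \<rightarrow>\<^sub>f fsub ?\<rho> (PVar (e []) \<Colon>\<^sub>f X))" if "X \<in> S1" for X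
    proof -
      \<comment> \<open>Applying \<open>\<tau>\<close> changes the body and the alternatives but not
        \<open>u\<close>, which is ground.\<close>
      have "LPV (u \<Colon>\<^sub>f (realise ?r A \<rightarrow>\<^sub>f fsub ?\<rho> X))"
        using LPV_fsub[OF u(2)[OF that], of \<tau>] u(1) by (simp add: realise_tsub fsub_fsub)
      from LPV_App_MP[OF this] show ?thesis using \<rho> by simp
    qed
    then have "condenses s (Box A) S (join (PVar 0) ?r ?r) ?\<rho>"
      using c' S1(3) False by (auto simp: condenses_def directed_imp_def)
    then show ?thesis using g' by blast
  qed
qed

theorem theorem7:
  fixes F :: s4v_fm
  assumes "S4V F"
  shows "\<exists>r. normal_realisation r F \<and> LPV (realise r F)"
proof -
  \<comment> \<open>Distinct paths receive distinct variables; \<open>Suc\<close> keeps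
    \<open>0\<close> free for the negative boxes of the final realisation.\<close>
  define e :: "path \<Rightarrow> nat" where "e p = Suc (list_encode p)" for p
  have e: "inj e" "0 \<notin> range e" by (auto simp: e_def inj_def list_encode_eq)
  obtain Bs where Bs: "set Bs \<subseteq> qreal True e F" "LPV (disjs Bs)"
    using S4V_quasi_realisation[OF assms] by blast
  obtain r \<sigma> where c: "condenses True F (set Bs) r \<sigma>"
    using condense[OF _ Bs(1) e] by auto
  \<comment> \<open>Each substituted alternative implies the condensed realisation, hence so does
    the substituted disjunction, which is provable by closure under substitution.\<close>
  have "LPV (fsub \<sigma> (disjs Bs) \<rightarrow>\<^sub>f realise r F)"
    unfolding map_fm_disjs
    by (rule LPV_disj_imp) (use c in \<open>auto simp: condenses_def directed_imp_def\<close>)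
  then have "LPV (realise r F)" using LPV_fsub[OF Bs(2)] by (rule LPV_MP)
  moreover have "normal_realisation r F" using c by (auto simp: condenses_def normal_realisation_def)
  ultimately show ?thesis by blast
qed

end
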